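(* Let $f:\mathbb{R}^N\to\mathbb{R}$ be twice continuously differentiable with $\|\nabla^2 f(x)\|_2\le L$ for all $x\in\mathbb{R}^N$ (where $L>0$), and $\inf_{x\in\mathbb{R}^N} f(x)>-\infty$. Let $0<\beta<\frac12$ and $$0<\gamma<\frac{1}{L}.$$ For $(x^0,x^1)\in\mathbb{R}^N\times\mathbb{R}^N$ let $(x^k)_{k\ge 0}$ be the sequence generated by the heavy-ball proximal point algorithm (HBPPA), $$x^{k+1}=\mathbf{Prox}_{\gamma f}\bigl(x^k+\beta(x^k-x^{k-1})\bigr),\qquad k\ge 1.$$ Then $$\mu\{(x^0,x^1)\in\mathbb{R}^{2N}:\ \lim_{k}x^k\in\chi^*_f\}=0,$$ that is, $\mu(W_{\mathrm{HBPPA}})=0$.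
   Context: $\|\cdot\|_2$ is the spectral norm and $\mu$ is Lebesgue measure. For a function $J$ (not necessarily convex), $\mathbf{Prox}_{J}(z):=\arg\min_{x}\{J(x)+\frac{\|x-z\|^2}{2}\}$. A point $x^*$ is a critical point of $f$ if $\nabla f(x^* )=0$; it is a strict saddle point of $f$ if it is a critical point and $\lambda_{\min}(\nabla^2 f(x^* ))<0$. $\chi^*_f$ denotes the set of strict saddle points of $f$. The condition $\lim_k x^k\in\chi^*_f$ means that the limit exists and belongs to $\chi^*_f$. For an iterative algorithm $\mathcal{M}$, $W_{\mathcal{M}}$ is the set of initial conditions from which the iterates converge to a strict saddle point; for HBPPA the initial condition is the pair $(x^0,x^1)$, so $W_{\mathrm{HBPPA}}=\{(x^0,x^1)\in\mathbb{R}^{2N}:\lim_k x^k\in\chi^*_f\}$. *)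

theory Defs
  imports "HOL-Analysis.Analysis"
begin

definition grad :: "(real^'n \<Rightarrow> real) \<Rightarrow> real^'n \<Rightarrow> real^'n" where
  "grad f x = (THE g. GDERIV f x :> g)"

definition hessian :: "(real^'n \<Rightarrow> real) \<Rightarrow> real^'n \<Rightarrow> real^'n^'n" where
  "hessian f x = matrix (frechet_derivative (grad f) (at x))"

definition twice_continuously_differentiable :: "(real^'n \<Rightarrow> real) \<Rightarrow> bool" where
  "twice_continuously_differentiable f \<longleftrightarrow>
     (\<forall>x. f differentiable (at x)) \<and>
     (\<forall>x. grad f differentiable (at x)) \<and>
     continuous_on UNIV (hessian f)"

text \<open>The norm on \<open>real^'n\<close> is Euclidean, so \<open>onorm\<close> is the operator norm induced by it.\<close>

definition spectral_norm :: "real^'n^'n \<Rightarrow> real" where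
  "spectral_norm A = onorm (\<lambda>v. A *v v)"

definition eigenvalues :: "real^'n^'n \<Rightarrow> real set" where
  "eigenvalues A = {c. \<exists>v. v \<noteq> 0 \<and> A *v v = c *\<^sub>R v}"

text \<open>
  Meaningful only when \<open>A\<close> has a real eigenvalue, as every symmetric matrix, hence every Hessian
  of a \<open>C\<^sup>2\<close> function, does; the set of eigenvalues is always finite.
\<close>

definition lambda_min :: "real^'n^'n \<Rightarrow> real" where
  "lambda_min A = Min (eigenvalues A)"

definition critical_point :: "(real^'n \<Rightarrow> real) \<Rightarrow> real^'n \<Rightarrow> bool" where
  "critical_point f x \<longleftrightarrow> grad f x = 0"

definition strict_saddle_points :: "(real^'n \<Rightarrow> real) \<Rightarrow> (real^'n) set" where
  "strict_saddle_points f = {x. critical_point f x \<and> lambda_min (hessian f x) < 0}"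

text \<open>
  \<open>arg_min\<close> picks some minimizer if there is one and is otherwise unspecified. If \<open>f\<close> is
  twice continuously differentiable with Hessian bounded by \<open>L\<close> in spectral norm, and
  \<open>0 < \<gamma> < 1 / L\<close>, then the objective in \<open>prox (\<lambda>x. \<gamma> * f x) z\<close> is strongly convex, so
  its minimizer exists and is unique.
\<close>

definition prox :: "(real^'n \<Rightarrow> real) \<Rightarrow> real^'n \<Rightarrow> real^'n" where
  "prox J z = arg_min (\<lambda>x. J x + (norm (x - z))\<^sup>2 / 2) (\<lambda>x. True)"

fun hbppa :: "(real^'n \<Rightarrow> real) \<Rightarrow> real \<Rightarrow> real \<Rightarrow> real^'n \<Rightarrow> real^'n \<Rightarrow> nat \<Rightarrow> real^'n" where
  "hbppa f \<gamma> \<beta> x0 x1 0 = x0"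
| "hbppa f \<gamma> \<beta> x0 x1 (Suc 0) = x1"
| "hbppa f \<gamma> \<beta> x0 x1 (Suc (Suc k)) =
     prox (\<lambda>x. \<gamma> * f x)
       (hbppa f \<gamma> \<beta> x0 x1 (Suc k) +
        \<beta> *\<^sub>R (hbppa f \<gamma> \<beta> x0 x1 (Suc k) - hbppa f \<gamma> \<beta> x0 x1 k))"

definition W_hbppa :: "(real^'n \<Rightarrow> real) \<Rightarrow> real \<Rightarrow> real \<Rightarrow> ((real^'n) \<times> (real^'n)) set" where
  "W_hbppa f \<gamma> \<beta> =
     {(x0, x1). \<exists>l \<in> strict_saddle_points f. hbppa f \<gamma> \<beta> x0 x1 \<longlonglongrightarrow> l}"

end

theory Submission
  imports Defs
begin

text \<open>
  The condition \<open>\<gamma> < 1 / L\<close> makes the map \<open>h x = x + \<gamma> *\<^sub>R grad f x\<close> strongly monotone, so the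
  proximal map is its globally Lipschitz inverse and the algorithm is the implicit recurrence
  \<open>h x\<^sub>k\<^sub>+\<^sub>2 = (1 + \<beta>) x\<^sub>k\<^sub>+\<^sub>1 - \<beta> x\<^sub>k\<close>. On pairs of consecutive iterates the step can be undone by
  an explicit differentiable map, so preimages of null sets under the iteration are null. By
  Lindelof's theorem it is therefore enough to find, around each strict saddle \<open>l\<close>, a ball such
  that only a null set of initial pairs has its whole orbit in that ball
  (\<open>negligible_orbits_near_strict_saddle\<close>).

  The centre-stable manifold theorem would give this; a direct argument with an energy replaces
  it here. The difference \<open>d\<close> of two orbits that stay near \<open>l\<close> satisfies
  \<open>M d\<^sub>k\<^sub>+\<^sub>2 = (1 + \<beta>) d\<^sub>k\<^sub>+\<^sub>1 - \<beta> d\<^sub>k\<close> with \<open>M = I + \<gamma> (hessian f l)\<close>, up to an error that is small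
  compared with \<open>d\<^sub>k\<^sub>+\<^sub>2\<close>. Put \<open>d\<^sub>k = \<rho>\<^sup>k w\<^sub>k\<close> with \<open>\<rho>\<close> slightly larger than \<open>1\<close>. The rescaled
  differences follow a heavy-ball recurrence with the symmetric matrix \<open>K = \<rho>\<^sup>2 M - a I\<close> in place
  of the Hessian, where \<open>a = (1 + \<beta>) \<rho> - \<beta>\<close>, and they dissipate the energy
  \<open>K w\<^sub>k \<bullet> w\<^sub>k + b \<parallel>w\<^sub>k - w\<^sub>k\<^sub>-\<^sub>1\<parallel>\<^sup>2\<close> for a suitable \<open>b\<close> (\<open>heavy_ball_energy\<close>). If \<open>K\<close> is injective,
  which holds for all but finitely many \<open>\<rho>\<close>, the dissipation also absorbs the error terms.
  Since \<open>l\<close> is a strict saddle, there is a vector \<open>e\<close> with \<open>(hessian f l *v e) \<bullet> e < 0\<close>, and then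
  \<open>K e \<bullet> e < 0\<close> for \<open>\<rho>\<close> close to \<open>1\<close>. If the two initial pairs differ by a nonzero multiple of
  \<open>(e, \<rho> *\<^sub>R e)\<close>, the energy starts negative; it never increases, whereas bounded \<open>d\<close> would force
  \<open>w\<close> and the energy to tend to \<open>0\<close>. So the set of initial pairs whose orbits stay in the ball
  meets every line with direction \<open>(e, \<rho> *\<^sub>R e)\<close> at most once. This set is compact, and a compact
  set with that property is null (\<open>negligible_if_lines_meet_once\<close>).
\<close>

section \<open>Null sets, Hessians and symmetric maps\<close>

text \<open>
  The translates of \<open>S\<close> by \<open>v / (n + 1)\<close> are pairwise disjoint, lie in one ball and all have the
  measure of \<open>S\<close>, which must therefore be zero.
\<close>

lemma negligible_if_lines_meet_once:
  fixes S :: "'a::euclidean_space set" and v :: 'a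
  assumes "compact S"
    and once: "\<And>x t. x \<in> S \<Longrightarrow> x + t *\<^sub>R v \<in> S \<Longrightarrow> t = 0"
  shows "negligible S"
proof -
  define shift where "shift n = (+) ((1 / real (Suc n)) *\<^sub>R v) ` S" for n
  have S: "S \<in> lmeasurable"
    using assms(1) by (rule lmeasurable_compact)
  have shift_meas: "shift n \<in> lmeasurable" for n
    unfolding shift_def using S by (rule measurable_translation)
  have shift_eq: "measure lebesgue (shift n) = measure lebesgue S" for n
    unfolding shift_def by (rule measure_translation)
  have disj: "disjoint_family shift"
    unfolding disjoint_family_on_def
  proof (intro ballI impI equals0I)
    fix m n z assume "m \<noteq> n" "z \<in> shift m \<inter> shift n"
    then obtain x y where xy: "x \<in> S" "y \<in> S"
      "(1 / real (Suc m)) *\<^sub>R v + x = (1 / real (Suc n)) *\<^sub>R v + y"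
      by (auto simp: shift_def)
    then have "y = x + (1 / real (Suc m) - 1 / real (Suc n)) *\<^sub>R v"
      by (simp add: algebra_simps)
    then have "1 / real (Suc m) - 1 / real (Suc n) = 0"
      using once xy by metis
    with \<open>m \<noteq> n\<close> show False
      by (simp del: of_nat_Suc)
  qed
  obtain R where R: "\<And>x. x \<in> S \<Longrightarrow> norm x \<le> R"
    using compact_imp_bounded[OF assms(1)] unfolding bounded_iff by blast
  define B where "B = cball (0::'a) (norm v + R)"
  have sub: "shift n \<subseteq> B" for n
  proof
    fix z assume "z \<in> shift n"
    then obtain x where x: "x \<in> S" "z = (1 / real (Suc n)) *\<^sub>R v + x"
      unfolding shift_def by blast
    have "norm z \<le> (1 / real (Suc n)) * norm v + norm x"
      unfolding x(2) by (rule order_trans[OF norm_triangle_ineq]) (simp del: of_nat_Suc)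
    also have "\<dots> \<le> 1 * norm v + R"
      by (rule add_mono[OF mult_right_mono R[OF x(1)]]) simp_all
    finally show "z \<in> B"
      by (simp add: B_def)
  qed
  have "real N * measure lebesgue S \<le> measure lebesgue B" for N
  proof -
    have "real N * measure lebesgue S = (\<Sum>n<N. measure lebesgue (shift n))"
      by (simp add: shift_eq)
    also have "\<dots> = measure lebesgue (\<Union>n<N. shift n)"
    proof (rule measure_finite_Union[symmetric])
      show "shift ` {..<N} \<subseteq> sets lebesgue"
        using fmeasurableD[OF shift_meas] by blast
      show "disjoint_family_on shift {..<N}"
        by (rule disjoint_family_on_mono[OF subset_UNIV disj])
      show "emeasure lebesgue (shift n) \<noteq> \<infinity>" for n
        using fmeasurableD2[OF shift_meas[of n]] by simp
    qed simp
    also have "\<dots> \<le> measure lebesgue B"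
    proof (rule measure_mono_fmeasurable)
      show "(\<Union>n<N. shift n) \<subseteq> B"
        using sub by (rule UN_least)
      show "(\<Union>n<N. shift n) \<in> sets lebesgue"
        by (rule sets.finite_UN) (simp_all add: fmeasurableD[OF shift_meas])
      show "B \<in> lmeasurable"
        by (simp add: B_def)
    qed
    finally show ?thesis .
  qed
  then have "measure lebesgue S \<le> 0"
    by (meson not_le reals_Archimedean3)
  then show ?thesis
    using S by (simp add: negligible_iff_measure measure_le_0_iff)
qed

text \<open>
  Symmetry of second derivatives, from differentiability of the gradient at a single point. The
  second difference of \<open>f\<close> along \<open>t u\<close> and \<open>t v\<close> is symmetric in \<open>u\<close> and \<open>v\<close>, and by the mean value
  theorem it equals \<open>t\<^sup>2 (A u \<bullet> v) + o(t\<^sup>2)\<close>.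
\<close>

lemma gradient_derivative_symmetric:
  fixes f :: "'a::real_inner \<Rightarrow> real"
  assumes f: "\<And>x. (f has_derivative (\<lambda>v. v \<bullet> G x)) (at x)"
    and G: "(G has_derivative A) (at l)"
  shows "A u \<bullet> v = u \<bullet> A v"
proof -
  interpret A: bounded_linear A
    using G by (rule has_derivative_bounded_linear)
  have main: "\<exists>d>0. \<forall>t. 0 < t \<and> t < d \<longrightarrow>
      \<bar>f (l + t *\<^sub>R u + t *\<^sub>R v) - f (l + t *\<^sub>R u) - f (l + t *\<^sub>R v) + f l - t\<^sup>2 * (A u \<bullet> v)\<bar> \<le> e * t\<^sup>2"
    if "e > 0" for e u v
  proof -
    \<comment> \<open>\<open>C\<close> is chosen so that two linearisation errors of relative size \<open>e / C\<close>, at distance at most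
      \<open>t (norm u + norm v + 1)\<close> from \<open>l\<close> and paired with \<open>v\<close>, add up to at most \<open>e t\<close>.\<close>
    define C where "C = 2 * (norm u + norm v + 1) * (norm v + 1)"
    have C: "C > 0"
      by (auto simp: C_def intro!: mult_pos_pos add_nonneg_pos)
    obtain d where d: "d > 0"
      and Gd: "\<And>y. norm (y - l) < d \<Longrightarrow> norm (G y - G l - A (y - l)) \<le> e / C * norm (y - l)"
      using G \<open>e > 0\<close> C unfolding has_derivative_at_alt by (metis divide_pos_pos)
    define d' where "d' = d / (norm u + norm v + 1)"
    have N: "norm u + norm v + 1 > 0"
      by (simp add: add_nonneg_pos)
    have "d' > 0"
      using d N by (simp add: d'_def)
    moreover have "\<bar>f (l + t *\<^sub>R u + t *\<^sub>R v) - f (l + t *\<^sub>R u) - f (l + t *\<^sub>R v) + f l - t\<^sup>2 * (A u \<bullet> v)\<bar> \<le> e * t\<^sup>2"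
      if t: "0 < t" "t < d'" for t
    proof -
      have line: "((\<lambda>s. f (c + s *\<^sub>R v)) has_derivative (\<lambda>h. (h *\<^sub>R v) \<bullet> G (c + s *\<^sub>R v))) (at s within X)"
        for c s X
        by (rule has_derivative_compose[OF _ f]) (auto intro!: derivative_eq_intros)
      define p where "p s = f (l + t *\<^sub>R u + s *\<^sub>R v) - f (l + s *\<^sub>R v)" for s
      have "(p has_derivative (\<lambda>h. (h *\<^sub>R v) \<bullet> G (l + t *\<^sub>R u + s *\<^sub>R v) - (h *\<^sub>R v) \<bullet> G (l + s *\<^sub>R v))) (at s within X)" for s X
        unfolding p_def by (intro has_derivative_diff line)
      then have "\<exists>s\<in>{0<..<t}. p t - p 0 =
          ((t - 0) *\<^sub>R v) \<bullet> G (l + t *\<^sub>R u + s *\<^sub>R v) - ((t - 0) *\<^sub>R v) \<bullet> G (l + s *\<^sub>R v)"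
        by (rule mvt_simple[OF t(1)])
      then obtain s where s: "0 < s" "s < t"
        and p: "p t - p 0 = t * (v \<bullet> (G (l + t *\<^sub>R u + s *\<^sub>R v) - G (l + s *\<^sub>R v)))"
        unfolding inner_diff_right right_diff_distrib by auto
      have small: "norm (a *\<^sub>R u + s *\<^sub>R v) \<le> t * (norm u + norm v + 1)" if "0 \<le> a" "a \<le> t" for a
      proof -
        have "norm (a *\<^sub>R u + s *\<^sub>R v) \<le> a * norm u + s * norm v"
          using that s by (intro order_trans[OF norm_triangle_ineq]) simp
        also have "\<dots> \<le> t * norm u + t * norm v + t"
          using that s t by (intro add_increasing2[OF less_imp_le] add_mono mult_right_mono) auto
        finally show ?thesis by (simp add: algebra_simps)
      qed
      have td: "t * (norm u + norm v + 1) < d"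
        using t(2) N by (simp add: d'_def field_simps)
      define \<eta> where "\<eta> = e / C * (t * (norm u + norm v + 1))"
      have est: "norm (G (l + (a *\<^sub>R u + s *\<^sub>R v)) - G l - A (a *\<^sub>R u + s *\<^sub>R v))
          \<le> \<eta>" if "0 \<le> a" "a \<le> t" for a
      proof -
        have "norm (G (l + (a *\<^sub>R u + s *\<^sub>R v)) - G l - A (a *\<^sub>R u + s *\<^sub>R v)) \<le> e / C * norm (a *\<^sub>R u + s *\<^sub>R v)"
          using Gd[of "l + (a *\<^sub>R u + s *\<^sub>R v)"] small[OF that] td by simp
        also have "\<dots> \<le> \<eta>"
          unfolding \<eta>_def using small[OF that] \<open>e > 0\<close> C by (intro mult_left_mono) auto
        finally show ?thesis .
      qed
      \<comment> \<open>Both gradients are compared with \<open>G l\<close>, since \<open>G\<close> is known to be differentiable only there.\<close>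
      define E where "E = (G (l + t *\<^sub>R u + s *\<^sub>R v) - G (l + s *\<^sub>R v)) - t *\<^sub>R A u"
      have "E = (G (l + (t *\<^sub>R u + s *\<^sub>R v)) - G l - A (t *\<^sub>R u + s *\<^sub>R v))
           - (G (l + (0 *\<^sub>R u + s *\<^sub>R v)) - G l - A (0 *\<^sub>R u + s *\<^sub>R v))"
        by (simp add: E_def A.add A.scaleR A.zero add.assoc)
      then have "norm E \<le> norm (G (l + (t *\<^sub>R u + s *\<^sub>R v)) - G l - A (t *\<^sub>R u + s *\<^sub>R v))
           + norm (G (l + (0 *\<^sub>R u + s *\<^sub>R v)) - G l - A (0 *\<^sub>R u + s *\<^sub>R v))"
        by (simp only: norm_triangle_ineq4)
      then have E: "norm E \<le> 2 * \<eta>"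
        using est[OF less_imp_le[OF t(1)] order_refl] est[OF order_refl less_imp_le[OF t(1)]]
        by linarith
      have "norm v * norm E \<le> (norm v + 1) * (2 * \<eta>)"
        using E by (intro mult_mono) auto
      also have "\<dots> = e * t * ((2 * (norm u + norm v + 1) * (norm v + 1)) / C)"
        by (simp only: \<eta>_def times_divide_eq_right times_divide_eq_left ac_simps)
      also have "\<dots> = e * t"
        unfolding C_def[symmetric] using C by simp
      finally have vE: "\<bar>v \<bullet> E\<bar> \<le> e * t"
        using Cauchy_Schwarz_ineq2[of v E] by linarith
      have "f (l + t *\<^sub>R u + t *\<^sub>R v) - f (l + t *\<^sub>R u) - f (l + t *\<^sub>R v) + f l - t\<^sup>2 * (A u \<bullet> v) = t * (v \<bullet> E)"
        using p by (simp add: p_def E_def inner_diff_right right_diff_distrib power2_eq_square inner_commute)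
      moreover have "\<bar>t * (v \<bullet> E)\<bar> \<le> t * (e * t)"
        unfolding abs_mult using vE t(1) by (simp add: mult_left_mono)
      ultimately show ?thesis
        by (simp only: power2_eq_square ac_simps)
    qed
    ultimately show ?thesis by blast
  qed
  have "\<bar>A u \<bullet> v - A v \<bullet> u\<bar> \<le> e" if e: "e > 0" for e
  proof -
    obtain d1 where d1: "d1 > 0" "\<And>t. 0 < t \<Longrightarrow> t < d1 \<Longrightarrow> 
       \<bar>f (l + t *\<^sub>R u + t *\<^sub>R v) - f (l + t *\<^sub>R u) - f (l + t *\<^sub>R v) + f l - t\<^sup>2 * (A u \<bullet> v)\<bar> \<le> e / 2 * t\<^sup>2"
      using main[OF half_gt_zero[OF e], of u v] by blast
    obtain d2 where d2: "d2 > 0" "\<And>t. 0 < t \<Longrightarrow> t < d2 \<Longrightarrow> 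
       \<bar>f (l + t *\<^sub>R v + t *\<^sub>R u) - f (l + t *\<^sub>R v) - f (l + t *\<^sub>R u) + f l - t\<^sup>2 * (A v \<bullet> u)\<bar> \<le> e / 2 * t\<^sup>2"
      using main[OF half_gt_zero[OF e], of v u] by blast
    define t where "t = min d1 d2 / 2"
    have t: "0 < t" "t < d1" "t < d2"
      using d1(1) d2(1) by (auto simp: t_def)
    have swap: "l + t *\<^sub>R v + t *\<^sub>R u = l + t *\<^sub>R u + t *\<^sub>R v"
      by (simp add: add.commute add.left_commute)
    have "\<bar>t\<^sup>2 * (A u \<bullet> v) - t\<^sup>2 * (A v \<bullet> u)\<bar> \<le> e / 2 * t\<^sup>2 + e / 2 * t\<^sup>2"
      using d1(2)[OF t(1,2)] d2(2)[OF t(1,3)] unfolding swap by linarith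
    also have "\<dots> = t\<^sup>2 * e"
      by (simp only: field_sum_of_halves flip: distrib_right) (simp add: mult.commute)
    finally have "t\<^sup>2 * \<bar>A u \<bullet> v - A v \<bullet> u\<bar> \<le> t\<^sup>2 * e"
      by (simp add: abs_mult flip: right_diff_distrib)
    then show ?thesis
      using t(1) by simp
  qed
  then have "\<bar>A u \<bullet> v - A v \<bullet> u\<bar> \<le> 0"
    by (rule field_le_epsilon) simp
  then show ?thesis
    by (simp add: inner_commute)
qed

text \<open>Eigenvectors of a symmetric map to distinct eigenvalues are orthogonal, hence independent.\<close>

lemma symmetric_map_eigenvalues_finite:
  fixes T :: "'a::euclidean_space \<Rightarrow> 'a"
  assumes sym: "\<And>u v. T u \<bullet> v = u \<bullet> T v"
  shows "finite {c::real. \<exists>v. v \<noteq> 0 \<and> T v = c *\<^sub>R v}" (is "finite ?E")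
proof -
  define ev where "ev c = (SOME v. v \<noteq> 0 \<and> T v = c *\<^sub>R v)" for c
  have ev: "ev c \<noteq> 0" "T (ev c) = c *\<^sub>R ev c" if "c \<in> ?E" for c
    using that someI_ex[of "\<lambda>v. v \<noteq> 0 \<and> T v = c *\<^sub>R v"] by (auto simp: ev_def)
  have orth: "ev c \<bullet> ev d = 0" if "c \<in> ?E" "d \<in> ?E" "c \<noteq> d" for c d
    using sym[of "ev c" "ev d"] that by (simp add: ev)
  have inj: "inj_on ev ?E"
  proof (rule inj_onI, rule ccontr)
    fix c d assume "c \<in> ?E" "d \<in> ?E" "ev c = ev d" "c \<noteq> d"
    then show False using orth[of c d] ev[of d] by simp
  qed
  have "independent (ev ` ?E)"
  proof (rule pairwise_orthogonal_independent)
    show "pairwise orthogonal (ev ` ?E)"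
    proof (rule pairwiseI)
      fix x y assume "x \<in> ev ` ?E" "y \<in> ev ` ?E" "x \<noteq> y"
      then obtain c d where cd: "c \<in> ?E" "d \<in> ?E" "x = ev c" "y = ev d"
        by blast
      with \<open>x \<noteq> y\<close> have "c \<noteq> d"
        by blast
      then show "orthogonal x y"
        unfolding orthogonal_def cd(3,4) by (intro orth cd)
    qed
    show "0 \<notin> ev ` ?E"
    proof
      assume "0 \<in> ev ` ?E"
      then obtain c where "c \<in> ?E" "ev c = 0"
        by (metis (no_types, lifting) imageE)
      then show False
        using ev(1)[of c] by blast
    qed
  qed
  then have "finite (ev ` ?E)"
    by (rule independent_imp_finite)
  then show ?thesis
    using inj by (rule finite_imageD)
qed

text \<open>
  A minimiser \<open>v\<close> of the Rayleigh quotient on the unit sphere is an eigenvector: the form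
  \<open>T w \<bullet> w - c (w \<bullet> w)\<close> is nonnegative and vanishes at \<open>v\<close>, so \<open>v\<close> lies in its kernel.
\<close>

lemma symmetric_map_has_eigenvalue:
  fixes T :: "'a::euclidean_space \<Rightarrow> 'a"
  assumes lin: "linear T" and sym: "\<And>u v. T u \<bullet> v = u \<bullet> T v"
  shows "\<exists>c::real. \<exists>v. v \<noteq> 0 \<and> T v = c *\<^sub>R v"
proof -
  interpret T: linear T by (rule lin)
  have "continuous_on (sphere 0 1) (\<lambda>v. T v \<bullet> v)"
    using lin by (intro continuous_intros linear_continuous_on linear_linear[THEN iffD2])
  moreover have "sphere (0::'a) 1 \<noteq> {}"
    by (rule vector_choose_size[of 1, simplified]) auto
  ultimately obtain v where v: "norm v = 1"
    and min: "\<And>w. norm w = 1 \<Longrightarrow> T v \<bullet> v \<le> T w \<bullet> w"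
    using continuous_attains_inf[of "sphere (0::'a) 1" "\<lambda>v. T v \<bullet> v"] by auto
  define c where "c = T v \<bullet> v"
  have nonneg: "T w \<bullet> w - c * (w \<bullet> w) \<ge> 0" for w
  proof (cases "w = 0")
    case False
    then have "c \<le> T (sgn w) \<bullet> sgn w"
      unfolding c_def by (intro min) (simp add: norm_sgn)
    also have "\<dots> = (T w \<bullet> w) / (norm w)\<^sup>2"
      by (simp add: sgn_div_norm T.scaleR power2_eq_square field_simps)
    finally show ?thesis
      using False by (simp add: field_simps power2_norm_eq_inner)
  qed (simp add: T.zero)
  define w where "w = T v - c *\<^sub>R v"
  have vv: "v \<bullet> v = 1"
    using v by (simp add: norm_eq_1)
  \<comment> \<open>The nonnegative form along \<open>v + t w\<close>; a small negative \<open>t\<close> contradicts this unless \<open>w = 0\<close>.\<close>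
  have quad: "2 * t * (w \<bullet> w) + t\<^sup>2 * (T w \<bullet> w - c * (w \<bullet> w)) \<ge> 0" for t
  proof -
    have "T w \<bullet> v = w \<bullet> T v" by (rule sym)
    then have "T (v + t *\<^sub>R w) \<bullet> (v + t *\<^sub>R w) - c * ((v + t *\<^sub>R w) \<bullet> (v + t *\<^sub>R w))
      = 2 * t * ((T v - c *\<^sub>R v) \<bullet> w) + t\<^sup>2 * (T w \<bullet> w - c * (w \<bullet> w))"
      by (simp add: T.add T.scaleR inner_simps algebra_simps power2_eq_square c_def vv inner_commute)
    then show ?thesis
      using nonneg[of "v + t *\<^sub>R w"] by (simp add: w_def)
  qed
  have "w \<bullet> w = 0"
  proof (rule ccontr)
    assume "w \<bullet> w \<noteq> 0"
    then have ww: "w \<bullet> w > 0" by simp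
    define q where "q = T w \<bullet> w - c * (w \<bullet> w)"
    have q: "q \<ge> 0" using nonneg[of w] by (simp add: q_def)
    define t where "t = - (w \<bullet> w) / (q + 1)"
    have t: "w \<bullet> w = - (t * (q + 1))" "t \<noteq> 0"
      using q ww by (auto simp: t_def)
    have "2 * t * (w \<bullet> w) + t\<^sup>2 * q = - (t\<^sup>2 * (q + 2))"
      unfolding t(1) by (simp add: algebra_simps power2_eq_square)
    moreover have "2 * t * (w \<bullet> w) + t\<^sup>2 * q \<ge> 0"
      unfolding q_def by (rule quad)
    moreover have "t\<^sup>2 * (q + 2) > 0"
      using t(2) q by (intro mult_pos_pos) auto
    ultimately show False by simp
  qed
  then have "T v = c *\<^sub>R v" by (simp add: w_def)
  moreover have "v \<noteq> 0" using v by auto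
  ultimately show ?thesis by blast
qed

section \<open>Instability of perturbed linear heavy-ball recurrences\<close>

text \<open>
  Testing \<open>K z + a (z - y) - \<beta> (y - x) = r\<close> against the increment \<open>q = z - y\<close> shows that the energy
  \<open>K y \<bullet> y + (\<beta> + c) \<parallel>y - x\<parallel>\<^sup>2\<close> drops in each step by at least
  \<open>c (\<parallel>z - y\<parallel>\<^sup>2 + \<parallel>y - x\<parallel>\<^sup>2) - 2 (r \<bullet> q)\<close>. The error \<open>r\<close> is controlled by \<open>\<parallel>z\<parallel>\<close>, which the
  dissipation does not see directly; but \<open>K\<close> is bounded below, so the recurrence itself bounds
  \<open>\<parallel>z\<parallel>\<close> by the two increments. A sequence that starts at rest with negative energy thus keeps
  it bounded away from \<open>0\<close> and cannot converge to \<open>0\<close>.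
\<close>

lemma heavy_ball_energy:
  fixes K :: "'a::euclidean_space \<Rightarrow> 'a" and a \<beta> \<kappa> :: real
  assumes lin: "linear K" and inj: "inj K" and sym: "\<And>u v. K u \<bullet> v = u \<bullet> K v"
    and lower: "\<And>v. - \<kappa> * (v \<bullet> v) \<le> K v \<bullet> v"
    and "0 < \<beta>" "\<beta> + \<kappa> / 2 < a"
  obtains \<epsilon> where "\<epsilon> > 0"
    "\<And>w :: nat \<Rightarrow> 'a.
       (\<And>k. norm (K (w (k + 2)) + a *\<^sub>R (w (k + 2) - w (k + 1)) - \<beta> *\<^sub>R (w (k + 1) - w k))
               \<le> \<epsilon> * norm (w (k + 2))) \<Longrightarrow>
       w \<longlonglongrightarrow> 0 \<Longrightarrow> w 1 = w 0 \<Longrightarrow> 0 \<le> K (w 0) \<bullet> w 0"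
proof -
  interpret K: linear K by (rule lin)
  obtain m where m: "m > 0" "\<And>v. m * norm v \<le> norm (K v)"
    using linear_inj_bounded_below_pos[OF lin inj] by blast
  define c where "c = (2 * a - 2 * \<beta> - \<kappa>) / 2"
  have c: "c > 0"
    using assms(6) by (simp add: c_def)
  define A where "A = \<bar>a\<bar> + \<beta>"
  have A: "A > 0" using \<open>0 < \<beta>\<close> by (simp add: A_def)
  \<comment> \<open>The first bound lets \<open>m \<parallel>z\<parallel>\<close> absorb the error in the estimate of \<open>\<parallel>z\<parallel>\<close>, the second makes the
    remaining error at most the dissipation.\<close>
  define \<epsilon> where "\<epsilon> = min (m / 2) (c * m / (8 * A))"
  have \<epsilon>: "\<epsilon> > 0" "\<epsilon> \<le> m / 2" "\<epsilon> * (8 * A) \<le> c * m"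
  proof -
    show "\<epsilon> > 0" "\<epsilon> \<le> m / 2"
      using m c A by (auto simp: \<epsilon>_def)
    have "\<epsilon> \<le> c * m / (8 * A)"
      by (simp add: \<epsilon>_def)
    then show "\<epsilon> * (8 * A) \<le> c * m"
      using A by (simp add: pos_le_divide_eq)
  qed
  have step: "K z \<bullet> z + (\<beta> + c) * (norm (z - y))\<^sup>2 \<le> K y \<bullet> y + (\<beta> + c) * (norm (y - x))\<^sup>2"
    if rec: "norm (K z + a *\<^sub>R (z - y) - \<beta> *\<^sub>R (y - x)) \<le> \<epsilon> * norm z" for x y z
  proof -
    define s q r where "s = y - x" and "q = z - y" and "r = K z + a *\<^sub>R q - \<beta> *\<^sub>R s"
    have r: "norm r \<le> \<epsilon> * norm z"
      using rec by (simp add: r_def q_def s_def)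
    have Kz: "K z = r - a *\<^sub>R q + \<beta> *\<^sub>R s"
      by (simp add: r_def)
    have "m * norm z \<le> norm (r - a *\<^sub>R q + \<beta> *\<^sub>R s)"
      using m(2)[of z] by (simp add: Kz)
    also have "\<dots> \<le> norm r + \<bar>a\<bar> * norm q + \<beta> * norm s"
      using norm_triangle_ineq[of "r - a *\<^sub>R q" "\<beta> *\<^sub>R s"] norm_triangle_ineq4[of r "a *\<^sub>R q"] \<open>0 < \<beta>\<close>
      by simp
    also have "norm r \<le> m / 2 * norm z"
      using r mult_right_mono[OF \<epsilon>(2), of "norm z"] by simp
    also have "\<bar>a\<bar> * norm q \<le> A * norm q"
      using \<open>0 < \<beta>\<close> by (intro mult_right_mono) (auto simp: A_def)
    also have "\<beta> * norm s \<le> A * norm s"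
      by (intro mult_right_mono) (auto simp: A_def)
    finally have z: "m * norm z \<le> 2 * A * (norm q + norm s)"
      by (simp add: algebra_simps)
    have "m * (norm r * norm q) \<le> m * (\<epsilon> * norm z * norm q)"
      using r m(1) by (intro mult_left_mono mult_right_mono) auto
    also have "\<dots> = \<epsilon> * norm q * (m * norm z)"
      by simp
    also have "\<dots> \<le> \<epsilon> * norm q * (2 * A * (norm q + norm s))"
      using z \<epsilon>(1) by (intro mult_left_mono) auto
    also have "\<dots> = \<epsilon> * (2 * A) * (norm q * (norm q + norm s))"
      by simp
    also have "\<dots> \<le> \<epsilon> * (2 * A) * (2 * ((norm q)\<^sup>2 + (norm s)\<^sup>2))"
    proof (rule mult_left_mono)
      have "0 \<le> (norm q - norm s / 2)\<^sup>2 + 7 / 4 * (norm s)\<^sup>2"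
        by simp
      then show "norm q * (norm q + norm s) \<le> 2 * ((norm q)\<^sup>2 + (norm s)\<^sup>2)"
        by (simp add: power2_eq_square algebra_simps)
    qed (use \<epsilon>(1) A in simp)
    also have "\<epsilon> * (2 * A) * (2 * ((norm q)\<^sup>2 + (norm s)\<^sup>2)) = \<epsilon> * (8 * A) * (((norm q)\<^sup>2 + (norm s)\<^sup>2) / 2)"
      by simp
    also have "\<dots> \<le> c * m * (((norm q)\<^sup>2 + (norm s)\<^sup>2) / 2)"
      using \<epsilon>(3) by (intro mult_right_mono) auto
    also have "\<dots> = m * (c * ((norm q)\<^sup>2 + (norm s)\<^sup>2) / 2)"
      by simp
    finally have "norm r * norm q \<le> c * ((norm q)\<^sup>2 + (norm s)\<^sup>2) / 2"
      using m(1) by (rule mult_left_le_imp_le)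
    then have rq: "2 * (r \<bullet> q) \<le> c * ((norm q)\<^sup>2 + (norm s)\<^sup>2)"
      using norm_cauchy_schwarz[of r q] by simp
    have sq: "2 * (s \<bullet> q) \<le> (norm s)\<^sup>2 + (norm q)\<^sup>2"
    proof -
      have "0 \<le> (s - q) \<bullet> (s - q)" by simp
      then show ?thesis
        by (simp add: inner_simps power2_norm_eq_inner inner_commute)
    qed
    have "K z \<bullet> y = z \<bullet> K y" by (rule sym)
    then have "K z \<bullet> z - K y \<bullet> y = 2 * (K z \<bullet> q) - K q \<bullet> q"
      by (simp add: q_def K.diff inner_simps inner_commute)
    also have "K z \<bullet> q = r \<bullet> q - a * (q \<bullet> q) + \<beta> * (s \<bullet> q)"
      by (simp add: Kz inner_simps)
    also have "2 * (r \<bullet> q - a * (q \<bullet> q) + \<beta> * (s \<bullet> q)) - K q \<bullet> q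
        \<le> c * ((norm q)\<^sup>2 + (norm s)\<^sup>2) - 2 * a * (norm q)\<^sup>2 + \<beta> * ((norm s)\<^sup>2 + (norm q)\<^sup>2) + \<kappa> * (norm q)\<^sup>2"
      using rq mult_left_mono[OF sq, of \<beta>] lower[of q] \<open>0 < \<beta>\<close>
      by (simp add: power2_norm_eq_inner algebra_simps)
    also have "\<dots> = (\<beta> + c) * (norm s)\<^sup>2 - (\<beta> + c) * (norm q)\<^sup>2"
      by (simp add: c_def field_simps)
    finally show ?thesis
      by (simp add: q_def s_def)
  qed
  show ?thesis
  proof (rule that[OF \<epsilon>(1)])
    fix w :: "nat \<Rightarrow> 'a"
    assume rec: "\<And>k. norm (K (w (k + 2)) + a *\<^sub>R (w (k + 2) - w (k + 1)) - \<beta> *\<^sub>R (w (k + 1) - w k))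
               \<le> \<epsilon> * norm (w (k + 2))"
      and lim: "w \<longlonglongrightarrow> 0" and start: "w 1 = w 0"
    define E where "E k = K (w (k + 1)) \<bullet> w (k + 1) + (\<beta> + c) * (norm (w (k + 1) - w k))\<^sup>2" for k
    have "decseq E"
      by (rule decseq_SucI) (use step rec in \<open>simp add: E_def\<close>)
    moreover have "E \<longlonglongrightarrow> 0"
    proof -
      have w1: "(\<lambda>k. w (k + 1)) \<longlonglongrightarrow> 0"
        using lim by (rule LIMSEQ_ignore_initial_segment)
      have "(\<lambda>k. K (w (k + 1))) \<longlonglongrightarrow> K 0"
        by (rule bounded_linear.tendsto[OF linear_linear[THEN iffD2, OF lin] w1])
      then have "E \<longlonglongrightarrow> K 0 \<bullet> 0 + (\<beta> + c) * (norm (0 - 0 :: 'a))\<^sup>2"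
        unfolding E_def by (intro tendsto_intros w1 lim)
      then show ?thesis by simp
    qed
    ultimately have "0 \<le> E 0"
      by (rule decseq_ge)
    then show "0 \<le> K (w 0) \<bullet> w 0"
      using start by (simp add: E_def)
  qed
qed

text \<open>
  The direction \<open>(e, \<rho> *\<^sub>R e)\<close> is unstable: after division by \<open>\<rho> ^ k\<close> the differences start at rest
  with negative energy, while boundedness would send them to \<open>0\<close>. The number \<open>\<epsilon>\<close> does not depend
  on the sequence, which is what allows \<open>M\<close> to be the linearisation of a nonlinear map. Taking
  \<open>\<rho> > 1\<close> is what makes the argument work in the presence of neutral directions: at \<open>\<rho> = 1\<close> the
  map \<open>K = M - I\<close> may be singular.
\<close>

lemma heavy_ball_linear_instability:
  fixes M :: "'a::euclidean_space \<Rightarrow> 'a" and \<beta> :: real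
  assumes lin: "linear M" and sym: "\<And>u v. M u \<bullet> v = u \<bullet> M v"
    and nonneg: "\<And>v. 0 \<le> M v \<bullet> v"
    and e: "M e \<bullet> e < e \<bullet> e"
    and \<beta>: "0 < \<beta>" "\<beta> < 1 / 2"
  obtains \<rho> \<epsilon> where "\<rho> > 1" "\<epsilon> > 0"
    "\<And>(d :: nat \<Rightarrow> 'a) t.
       (\<And>k. norm (M (d (k + 2)) - (1 + \<beta>) *\<^sub>R d (k + 1) + \<beta> *\<^sub>R d k) \<le> \<epsilon> * norm (d (k + 2))) \<Longrightarrow>
       bounded (range d) \<Longrightarrow> d 0 = t *\<^sub>R e \<Longrightarrow> d 1 = \<rho> *\<^sub>R d 0 \<Longrightarrow> t = 0"
proof -
  interpret M: linear M by (rule lin)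
  define a where "a \<rho> = (1 + \<beta>) * \<rho> - \<beta>" for \<rho>
  have "((\<lambda>\<rho>. \<rho>\<^sup>2 * (M e \<bullet> e) - a \<rho> * (e \<bullet> e)) \<longlongrightarrow> 1\<^sup>2 * (M e \<bullet> e) - a 1 * (e \<bullet> e)) (at_right 1)"
    unfolding a_def by (intro tendsto_intros)
  then have "\<forall>\<^sub>F \<rho> in at_right 1. \<rho>\<^sup>2 * (M e \<bullet> e) - a \<rho> * (e \<bullet> e) < 0"
    by (rule order_tendstoD(2)) (use e in \<open>simp add: a_def\<close>)
  then obtain b where b: "b > 1"
    "\<And>\<rho>. 1 < \<rho> \<Longrightarrow> \<rho> < b \<Longrightarrow> \<rho>\<^sup>2 * (M e \<bullet> e) - a \<rho> * (e \<bullet> e) < 0"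
    unfolding eventually_at_right_field by blast
  define Eig where "Eig = {c::real. \<exists>v. v \<noteq> 0 \<and> M v = c *\<^sub>R v}"
  \<comment> \<open>\<open>\<rho>\<^sup>2 M - a \<rho>\<close> is singular exactly when \<open>a \<rho> / \<rho>\<^sup>2\<close> is an eigenvalue of \<open>M\<close>. This quotient is
    injective in \<open>\<rho> > 1\<close>, so only finitely many \<open>\<rho>\<close> have to be avoided.\<close>
  have "inj_on (\<lambda>\<rho>. a \<rho> / \<rho>\<^sup>2) {1<..<b}"
  proof (rule inj_onI)
    fix \<rho> \<sigma> assume "\<rho> \<in> {1<..<b}" "\<sigma> \<in> {1<..<b}" and eq: "a \<rho> / \<rho>\<^sup>2 = a \<sigma> / \<sigma>\<^sup>2"
    then have gt: "\<rho> > 1" "\<sigma> > 1" by auto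
    define s t where "s = 1 / \<rho>" and "t = 1 / \<sigma>"
    have "a \<rho> / \<rho>\<^sup>2 = (1 + \<beta>) * s - \<beta> * s\<^sup>2" "a \<sigma> / \<sigma>\<^sup>2 = (1 + \<beta>) * t - \<beta> * t\<^sup>2"
      using gt by (simp_all add: a_def s_def t_def field_simps power2_eq_square)
    with eq have "(s - t) * ((1 + \<beta>) - \<beta> * (s + t)) = 0"
      by (simp add: algebra_simps power2_eq_square)
    moreover have "\<beta> * (s + t) < 1 + \<beta>"
    proof -
      have "s \<le> 1" "t \<le> 1"
        using gt by (simp_all add: s_def t_def)
      then have "\<beta> * (s + t) \<le> \<beta> * 2"
        using \<beta> by (intro mult_left_mono) auto
      also have "\<dots> < 1 + \<beta>"
        using \<beta> by simp
      finally show ?thesis .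
    qed
    ultimately have "s = t" by simp
    then show "\<rho> = \<sigma>" using gt by (simp add: s_def t_def)
  qed
  moreover have "finite Eig"
    unfolding Eig_def by (rule symmetric_map_eigenvalues_finite[OF sym])
  ultimately have "finite ((\<lambda>\<rho>. a \<rho> / \<rho>\<^sup>2) -` Eig \<inter> {1<..<b})"
    by (rule finite_vimage_IntI[rotated])
  then have "infinite ({1<..<b} - (\<lambda>\<rho>. a \<rho> / \<rho>\<^sup>2) -` Eig \<inter> {1<..<b})"
    using infinite_Ioo[OF b(1)] by (rule Diff_infinite_finite)
  then have "{1<..<b} - (\<lambda>\<rho>. a \<rho> / \<rho>\<^sup>2) -` Eig \<inter> {1<..<b} \<noteq> {}"
    by (rule infinite_imp_nonempty)
  then obtain \<rho> where "\<rho> \<in> {1<..<b} - (\<lambda>\<rho>. a \<rho> / \<rho>\<^sup>2) -` Eig \<inter> {1<..<b}"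
    by blast
  then have \<rho>: "1 < \<rho>" "\<rho> < b" "a \<rho> / \<rho>\<^sup>2 \<notin> Eig"
    by auto
  define K where "K v = \<rho>\<^sup>2 *\<^sub>R M v - a \<rho> *\<^sub>R v" for v
  have linK: "linear K"
    unfolding K_def by (intro linear_compose_sub linear_compose_scale_right lin linear_id[unfolded id_def])
  interpret K: linear K by (rule linK)
  have injK: "inj K"
    unfolding K.inj_iff_eq_0
  proof (intro allI impI)
    fix v assume "K v = 0"
    then have "\<rho>\<^sup>2 *\<^sub>R M v = a \<rho> *\<^sub>R v"
      by (simp add: K_def)
    then have "(1 / \<rho>\<^sup>2) *\<^sub>R (\<rho>\<^sup>2 *\<^sub>R M v) = (1 / \<rho>\<^sup>2) *\<^sub>R (a \<rho> *\<^sub>R v)"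
      by (rule arg_cong)
    then have "M v = (a \<rho> / \<rho>\<^sup>2) *\<^sub>R v"
      using \<rho>(1) by simp
    then show "v = 0"
      using \<rho>(3) unfolding Eig_def by blast
  qed
  have symK: "K u \<bullet> v = u \<bullet> K v" for u v
    by (simp add: K_def inner_simps sym)
  have lowK: "- a \<rho> * (v \<bullet> v) \<le> K v \<bullet> v" for v
    using mult_nonneg_nonneg[OF zero_le_power2 nonneg, of \<rho> v] by (simp add: K_def inner_simps)
  have big: "\<beta> + a \<rho> / 2 < a \<rho>"
  proof -
    have "1 * (1 + \<beta>) < \<rho> * (1 + \<beta>)"
      using \<rho>(1) \<beta>(1) by (intro mult_strict_right_mono) auto
    then have "1 < a \<rho>"
      by (simp add: a_def mult.commute)
    then show ?thesis
      using \<beta>(2) by linarith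
  qed
  obtain \<epsilon> where \<epsilon>: "\<epsilon> > 0" and stable: "\<And>w :: nat \<Rightarrow> 'a.
       (\<And>k. norm (K (w (k + 2)) + a \<rho> *\<^sub>R (w (k + 2) - w (k + 1)) - \<beta> *\<^sub>R (w (k + 1) - w k))
               \<le> \<epsilon> * norm (w (k + 2))) \<Longrightarrow>
       w \<longlonglongrightarrow> 0 \<Longrightarrow> w 1 = w 0 \<Longrightarrow> 0 \<le> K (w 0) \<bullet> w 0"
    by (rule heavy_ball_energy[OF linK injK symK lowK \<beta>(1) big]) blast
  show ?thesis
  proof (rule that[OF \<rho>(1), of "\<epsilon> / \<rho>\<^sup>2"])
    show "\<epsilon> / \<rho>\<^sup>2 > 0"
      using \<epsilon> \<rho>(1) by simp
    fix d :: "nat \<Rightarrow> 'a" and t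
    assume rec: "\<And>k. norm (M (d (k + 2)) - (1 + \<beta>) *\<^sub>R d (k + 1) + \<beta> *\<^sub>R d k) \<le> \<epsilon> / \<rho>\<^sup>2 * norm (d (k + 2))"
      and bd: "bounded (range d)" and d0: "d 0 = t *\<^sub>R e" and d1: "d 1 = \<rho> *\<^sub>R d 0"
    define w where "w k = (1 / \<rho> ^ k) *\<^sub>R d k" for k
    have d_w: "d k = \<rho> ^ k *\<^sub>R w k" for k
      using \<rho>(1) by (simp add: w_def)
    have "norm (K (w (k + 2)) + a \<rho> *\<^sub>R (w (k + 2) - w (k + 1)) - \<beta> *\<^sub>R (w (k + 1) - w k))
               \<le> \<epsilon> * norm (w (k + 2))" (is "norm ?lhs \<le> _") for k
    proof -
      have "M (d (k + 2)) - (1 + \<beta>) *\<^sub>R d (k + 1) + \<beta> *\<^sub>R d k = \<rho> ^ k *\<^sub>R ?lhs"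
        by (simp add: d_w M.scaleR K_def a_def algebra_simps power2_eq_square)
      then have "\<rho> ^ k * norm ?lhs \<le> \<epsilon> / \<rho>\<^sup>2 * norm (d (k + 2))"
        using rec[of k] \<rho>(1) by simp
      also have "\<dots> = \<rho> ^ k * (\<epsilon> * norm (w (k + 2)))"
        using \<rho>(1) by (simp add: d_w power_add power2_eq_square)
      finally show ?thesis
        using \<rho>(1) by simp
    qed
    moreover have "w \<longlonglongrightarrow> 0"
    proof -
      obtain B where B: "\<And>k. norm (d k) \<le> B"
        using bd unfolding bounded_iff by blast
      have "(\<lambda>k. B * (1 / \<rho>) ^ k) \<longlonglongrightarrow> B * 0"
        using \<rho>(1) by (intro tendsto_intros LIMSEQ_power_zero) auto
      moreover have "norm (w k) \<le> B * (1 / \<rho>) ^ k" for k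
        using B[of k] \<rho>(1) by (simp add: w_def divide_right_mono power_one_over)
      ultimately show ?thesis
        by (intro Lim_null_comparison[of w "\<lambda>k. B * (1 / \<rho>) ^ k"]) auto
    qed
    moreover have "w 1 = w 0"
      using \<rho>(1) d1 by (simp add: w_def)
    ultimately have "0 \<le> K (w 0) \<bullet> w 0"
      by (rule stable)
    also have "K (w 0) \<bullet> w 0 = t\<^sup>2 * (\<rho>\<^sup>2 * (M e \<bullet> e) - a \<rho> * (e \<bullet> e))"
      by (simp add: w_def d0 K.scaleR) (simp add: K_def inner_simps power2_eq_square)
    finally show "t = 0"
      using b(2)[OF \<rho>(1,2)] by (simp add: zero_le_mult_iff)
  qed
qed

section \<open>The proximal map of a function with bounded Hessian\<close>

lemma gradient_has_derivative:
  fixes f :: "real^'n \<Rightarrow> real"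
  assumes "f differentiable (at x)"
  shows "(f has_derivative (\<lambda>v. v \<bullet> grad f x)) (at x)"
proof -
  obtain D where D: "(f has_derivative D) (at x)"
    using assms unfolding differentiable_def by blast
  interpret D: linear D
    using D by (rule has_derivative_linear)
  define g where "g = (\<Sum>b\<in>Basis. D b *\<^sub>R b)"
  have "D v = v \<bullet> g" for v
  proof -
    have "D v = D (\<Sum>b\<in>Basis. (v \<bullet> b) *\<^sub>R b)"
      by (simp add: euclidean_representation)
    also have "\<dots> = v \<bullet> g"
      by (simp add: D.sum D.scaleR g_def inner_sum_right mult.commute)
    finally show ?thesis .
  qed
  then have g: "GDERIV f x :> g"
    using D unfolding gderiv_def by (metis (no_types, lifting) ext)
  have "grad f x = g"
    unfolding grad_def
  proof (rule the_equality[where P = "\<lambda>g. GDERIV f x :> g", OF g])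
    fix g' assume "GDERIV f x :> g'"
    then have "(\<lambda>v. v \<bullet> g') = (\<lambda>v. v \<bullet> g)"
      using g unfolding gderiv_def by (rule has_derivative_unique)
    then show "g' = g"
      by (metis vector_eq_ldot)
  qed
  then show ?thesis
    using g unfolding gderiv_def by simp
qed

lemma hessian_has_derivative:
  fixes f :: "real^'n \<Rightarrow> real"
  assumes "grad f differentiable (at x)"
  shows "(grad f has_derivative (\<lambda>v. hessian f x *v v)) (at x)"
proof -
  have "(grad f has_derivative frechet_derivative (grad f) (at x)) (at x)"
    using assms by (simp add: frechet_derivative_works)
  moreover from has_derivative_linear[OF this]
  have "(\<lambda>v. hessian f x *v v) = frechet_derivative (grad f) (at x)"
    unfolding hessian_def by (rule matrix_vector_mul(2))
  ultimately show ?thesis by simp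
qed

locale heavy_ball_prox =
  fixes f :: "real^'n \<Rightarrow> real" and L \<beta> \<gamma> :: real
  assumes C2: "twice_continuously_differentiable f"
    and L: "L > 0"
    and hessian_le: "\<And>x. spectral_norm (hessian f x) \<le> L"
    and bdd: "bdd_below (range f)"
    and \<beta>: "0 < \<beta>" "\<beta> < 1 / 2"
    and \<gamma>: "0 < \<gamma>" "\<gamma> < 1 / L"
begin

lemma \<gamma>L: "\<gamma> * L < 1"
  using L \<gamma> by (simp add: field_simps)

lemma f_derivative: "(f has_derivative (\<lambda>v. v \<bullet> grad f x)) (at x)"
  using C2 unfolding twice_continuously_differentiable_def by (simp add: gradient_has_derivative)

lemma grad_derivative: "(grad f has_derivative (\<lambda>v. hessian f x *v v)) (at x)"
  using C2 unfolding twice_continuously_differentiable_def by (simp add: hessian_has_derivative)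

lemma hessian_symmetric: "(hessian f x *v u) \<bullet> v = u \<bullet> (hessian f x *v v)"
  by (rule gradient_derivative_symmetric[OF f_derivative grad_derivative])

lemma grad_lipschitz: "norm (grad f x - grad f y) \<le> L * norm (x - y)"
  by (rule differentiable_bound[where S = UNIV and f' = "\<lambda>x v. hessian f x *v v"])
     (use hessian_le in \<open>auto simp: grad_derivative spectral_norm_def\<close>)

lemma hessian_bound: "norm (hessian f x *v v) \<le> L * norm v"
proof -
  have "norm (hessian f x *v v) \<le> onorm (\<lambda>v. hessian f x *v v) * norm v"
    by (rule onorm[OF has_derivative_bounded_linear[OF grad_derivative]])
  also have "\<dots> \<le> L * norm v"
    using hessian_le[of x] by (intro mult_right_mono) (auto simp: spectral_norm_def)
  finally show ?thesis .
qed

definition prox_inverse :: "real^'n \<Rightarrow> real^'n" where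
  "prox_inverse x = x + \<gamma> *\<^sub>R grad f x"

lemma prox_inverse_expands: "(1 - \<gamma> * L) * norm (x - y) \<le> norm (prox_inverse x - prox_inverse y)"
proof -
  have "norm (x - y) \<le> norm (prox_inverse x - prox_inverse y) + norm (\<gamma> *\<^sub>R (grad f x - grad f y))"
    using norm_triangle_ineq4[of "prox_inverse x - prox_inverse y" "\<gamma> *\<^sub>R (grad f x - grad f y)"]
    by (simp add: prox_inverse_def algebra_simps)
  also have "norm (\<gamma> *\<^sub>R (grad f x - grad f y)) \<le> \<gamma> * (L * norm (x - y))"
    using grad_lipschitz[of x y] \<gamma> by simp
  finally show ?thesis
    by (simp add: algebra_simps)
qed

text \<open>
  The objective of the proximal problem has a global minimiser, because it is continuous and,
  \<open>f\<close> being bounded below, is at least its value at \<open>z\<close> outside a ball. At a minimiser its gradient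
  \<open>prox_inverse p - z\<close> vanishes.
\<close>

lemma prox_inverse_prox: "prox_inverse (prox (\<lambda>x. \<gamma> * f x) z) = z"
proof -
  define J where "J x = \<gamma> * f x + (norm (x - z))\<^sup>2 / 2" for x
  have contf: "continuous_on UNIV f"
    by (intro continuous_at_imp_continuous_on ballI has_derivative_continuous[OF f_derivative])
  obtain m where m: "\<And>x. m \<le> f x"
    using bdd unfolding bdd_below_def by blast
  define D where "D = J z - \<gamma> * m"
  have D: "D \<ge> 0"
    using m[of z] \<gamma> by (simp add: D_def J_def)
  \<comment> \<open>\<open>R\<^sup>2 / 2 \<ge> D\<close>, so outside the ball of radius \<open>R\<close> the quadratic term alone outweighs the drop of
    \<open>\<gamma> f\<close> from its value at \<open>z\<close>, which is at most \<open>D\<close>.\<close>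
  define R where "R = 2 * (D + 1)"
  have "\<exists>x\<in>cball z R. \<forall>y\<in>cball z R. J x \<le> J y"
  proof (rule continuous_attains_inf)
    show "cball z R \<noteq> {}"
      using D by (simp add: R_def)
    show "continuous_on (cball z R) J"
      unfolding J_def by (intro continuous_intros continuous_on_subset[OF contf]) auto
  qed simp
  then obtain x0 where x0: "\<And>y. y \<in> cball z R \<Longrightarrow> J x0 \<le> J y"
    by blast
  have "J x0 \<le> J y" for y
  proof (cases "y \<in> cball z R")
    case False
    then have "R < norm (y - z)"
      by (simp add: dist_norm norm_minus_commute)
    then have "R\<^sup>2 \<le> (norm (y - z))\<^sup>2"
      using D by (intro power_mono) (auto simp: R_def)
    have "2 * D \<le> (2 * D) * (D + 2) + 2"
      using D by (simp add: distrib_left)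
    also have "\<dots> = R\<^sup>2 / 2"
      by (simp add: R_def power2_eq_square algebra_simps)
    also have "\<dots> \<le> (norm (y - z))\<^sup>2 / 2"
      using \<open>R\<^sup>2 \<le> (norm (y - z))\<^sup>2\<close> by simp
    finally have "D \<le> (norm (y - z))\<^sup>2 / 2"
      using D by simp
    moreover have "\<gamma> * m \<le> \<gamma> * f y"
      using m[of y] \<gamma> by simp
    ultimately have "D + \<gamma> * m \<le> J y"
      unfolding J_def by simp
    then have "J z \<le> J y"
      by (simp add: D_def)
    moreover have "J x0 \<le> J z"
      using D by (intro x0) (simp add: R_def)
    ultimately show ?thesis by simp
  qed (rule x0)
  moreover define p where "p = prox (\<lambda>x. \<gamma> * f x) z"
  ultimately have min: "J p \<le> J y" for y
    using arg_min_equality[of "\<lambda>_. True" x0 J] unfolding p_def prox_def J_def by simp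
  have "(J has_derivative (\<lambda>v. v \<bullet> (prox_inverse p - z))) (at p)"
  proof -
    have "(J has_derivative (\<lambda>v. \<gamma> * (v \<bullet> grad f p) + (v \<bullet> (p - z) + (p - z) \<bullet> v) / 2)) (at p)"
      unfolding J_def power2_norm_eq_inner
      by (auto intro!: derivative_eq_intros f_derivative simp: inner_commute)
    then show ?thesis
      by (simp add: prox_inverse_def inner_simps inner_commute diff_divide_distrib algebra_simps)
  qed
  then have "(\<lambda>v. v \<bullet> (prox_inverse p - z)) = (\<lambda>v. 0)"
    by (rule differential_zero_maxmin[of p UNIV, rotated 2]) (auto simp: min)
  from fun_cong[OF this, of "prox_inverse p - z"] show ?thesis
    by (simp add: p_def)
qed

lemma prox_continuous: "continuous_on UNIV (prox (\<lambda>x. \<gamma> * f x))"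
proof (rule lipschitz_on_continuous_on)
  show "(1 / (1 - \<gamma> * L))-lipschitz_on UNIV (prox (\<lambda>x. \<gamma> * f x))"
  proof (rule lipschitz_onI)
    fix x y
    show "dist (prox (\<lambda>x. \<gamma> * f x) x) (prox (\<lambda>x. \<gamma> * f x) y) \<le> 1 / (1 - \<gamma> * L) * dist x y"
      using prox_inverse_expands[of "prox (\<lambda>x. \<gamma> * f x) x" "prox (\<lambda>x. \<gamma> * f x) y"] \<gamma>L
      by (simp add: prox_inverse_prox dist_norm field_simps)
  qed (use \<gamma>L in simp)
qed

section \<open>Orbits near a strict saddle\<close>

abbreviation orbit :: "real^'n \<Rightarrow> real^'n \<Rightarrow> nat \<Rightarrow> real^'n" where
  "orbit \<equiv> hbppa f \<gamma> \<beta>"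

lemma orbit_recurrence:
  "prox_inverse (orbit x0 x1 (k + 2)) = (1 + \<beta>) *\<^sub>R orbit x0 x1 (k + 1) - \<beta> *\<^sub>R orbit x0 x1 k"
  by (simp add: prox_inverse_prox algebra_simps)

lemma orbit_shift: "orbit x0 x1 (Suc k) = orbit x1 (orbit x0 x1 2) k"
proof (induction k rule: induct_nat_012)
  case 1
  show ?case by (simp only: numeral_2_eq_2 hbppa.simps(2))
next
  case (ge2 k)
  then show ?case by (simp only: hbppa.simps(3))
qed simp

lemma orbit_continuous: "continuous_on UNIV (\<lambda>z. orbit (fst z) (snd z) k)"
proof -
  have "continuous_on UNIV (\<lambda>z. orbit (fst z) (snd z) k) \<and>
        continuous_on UNIV (\<lambda>z. orbit (fst z) (snd z) (Suc k))"
  proof (induction k)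
    case 0
    then show ?case by (auto intro: continuous_intros)
  next
    case (Suc k)
    then have "continuous_on UNIV (\<lambda>z. orbit (fst z) (snd z) (Suc k) +
        \<beta> *\<^sub>R (orbit (fst z) (snd z) (Suc k) - orbit (fst z) (snd z) k))"
      by (intro continuous_intros) auto
    then have "continuous_on UNIV (\<lambda>z. orbit (fst z) (snd z) (Suc (Suc k)))"
      unfolding hbppa.simps by (rule continuous_on_compose2[OF prox_continuous]) simp
    with Suc show ?case by blast
  qed
  then show ?thesis ..
qed

text \<open>
  Strict differentiability at \<open>l\<close>, a consequence of the continuity of the Hessian. The strict form
  is the useful one because two orbits near \<open>l\<close> are compared with each other, not with \<open>l\<close>.
\<close>

lemma prox_inverse_almost_linear:
  assumes "\<epsilon> > 0"
  obtains r where "r > 0"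
    "\<And>x y. x \<in> cball l r \<Longrightarrow> y \<in> cball l r \<Longrightarrow>
      norm (prox_inverse x - prox_inverse y - ((x - y) + \<gamma> *\<^sub>R (hessian f l *v (x - y)))) \<le> \<epsilon> * norm (x - y)"
proof -
  define \<delta> where "\<delta> x = (\<Sum>i\<in>UNIV. \<Sum>j\<in>UNIV. \<bar>(hessian f x - hessian f l) $ i $ j\<bar>)" for x
  have "continuous_on UNIV \<delta>"
    using C2 unfolding \<delta>_def twice_continuously_differentiable_def by (intro continuous_intros) auto
  then have "isCont \<delta> l"
    by (simp add: continuous_on_eq_continuous_at)
  then have "(\<delta> \<longlongrightarrow> \<delta> l) (nhds l)"
    unfolding isCont_def tendsto_at_iff_tendsto_nhds .
  moreover have "\<delta> l < \<epsilon> / \<gamma>"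
    using assms \<gamma> by (simp add: \<delta>_def)
  ultimately have "\<forall>\<^sub>F x in nhds l. \<delta> x < \<epsilon> / \<gamma>"
    by (rule order_tendstoD(2))
  then obtain d where d: "d > 0" "\<And>x. dist x l < d \<Longrightarrow> \<delta> x < \<epsilon> / \<gamma>"
    unfolding eventually_nhds_metric by blast
  show ?thesis
  proof (rule that[of "d / 2"])
    show "d / 2 > 0" using d by simp
    fix x y assume xy: "x \<in> cball l (d / 2)" "y \<in> cball l (d / 2)"
    define g where "g x = grad f x - hessian f l *v x" for x
    have "norm (g x - g y) \<le> \<epsilon> / \<gamma> * norm (x - y)"
    proof (rule differentiable_bound[where S = "cball l (d / 2)" and f' = "\<lambda>x v. (hessian f x - hessian f l) *v v"])
      fix x assume "x \<in> cball l (d / 2)"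
      then have "\<delta> x \<le> \<epsilon> / \<gamma>"
        using d by (intro less_imp_le d(2)) (auto simp: dist_commute)
      then show "onorm ((*v) (hessian f x - hessian f l)) \<le> \<epsilon> / \<gamma>"
        using onorm_le_matrix_component_sum[of "hessian f x - hessian f l"] by (simp add: \<delta>_def)
      have "(g has_derivative (\<lambda>v. hessian f x *v v - hessian f l *v v)) (at x)"
        unfolding g_def
        by (intro has_derivative_diff grad_derivative bounded_linear_imp_has_derivative matrix_vector_mul_bounded_linear)
      then show "(g has_derivative (\<lambda>v. (hessian f x - hessian f l) *v v)) (at x within cball l (d / 2))"
        by (simp add: matrix_vector_mult_diff_rdistrib has_derivative_at_withinI)
    qed (use xy in auto)
    then have "\<gamma> * norm (g x - g y) \<le> \<epsilon> * norm (x - y)"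
      using \<gamma> by (simp add: field_simps)
    moreover have "prox_inverse x - prox_inverse y - ((x - y) + \<gamma> *\<^sub>R (hessian f l *v (x - y))) = \<gamma> *\<^sub>R (g x - g y)"
      by (simp add: prox_inverse_def g_def matrix_vector_mult_diff_distrib algebra_simps)
    ultimately show "norm (prox_inverse x - prox_inverse y - ((x - y) + \<gamma> *\<^sub>R (hessian f l *v (x - y)))) \<le> \<epsilon> * norm (x - y)"
      using \<gamma> by simp
  qed
qed

end

text \<open>
  Since \<open>lambda_min\<close> is a minimum over the set of eigenvalues, it is an eigenvalue only because that
  set is finite and nonempty, as it is for symmetric matrices.
\<close>

lemma negative_lambda_min_direction:
  fixes A :: "real^'n^'n"
  assumes sym: "\<And>u v. (A *v u) \<bullet> v = u \<bullet> (A *v v)" and "lambda_min A < 0"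
  obtains e where "(A *v e) \<bullet> e < 0"
proof -
  have "finite (eigenvalues A)"
    unfolding eigenvalues_def by (rule symmetric_map_eigenvalues_finite[OF sym])
  moreover have "eigenvalues A \<noteq> {}"
    using symmetric_map_has_eigenvalue[of "\<lambda>v. A *v v", OF _ sym] unfolding eigenvalues_def by auto
  ultimately have "lambda_min A \<in> eigenvalues A"
    unfolding lambda_min_def by (rule Min_in)
  then obtain v where "v \<noteq> 0" "A *v v = lambda_min A *\<^sub>R v"
    unfolding eigenvalues_def by blast
  then show ?thesis
    using \<open>lambda_min A < 0\<close> by (intro that[of v]) (simp add: mult_neg_pos)
qed

context heavy_ball_prox
begin

text \<open>
  Two orbits that stay close to \<open>l\<close> and whose initial pairs differ by \<open>t *\<^sub>R (e, \<rho> *\<^sub>R e)\<close> have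
  bounded differences that almost solve the linearised recurrence, so \<open>t = 0\<close> by
  \<open>heavy_ball_linear_instability\<close>.
\<close>

lemma negligible_orbits_near_strict_saddle:
  assumes "l \<in> strict_saddle_points f"
  obtains r where "r > 0" "negligible {(x0, x1). \<forall>k. orbit x0 x1 k \<in> cball l r}"
proof -
  define M where "M v = v + \<gamma> *\<^sub>R (hessian f l *v v)" for v
  have linM: "linear M"
    unfolding M_def by (intro linear_compose_add linear_compose_scale_right matrix_vector_mul_linear linear_id[unfolded id_def])
  interpret M: linear M by (rule linM)
  have symM: "M u \<bullet> v = u \<bullet> M v" for u v
    by (simp add: M_def inner_simps hessian_symmetric)
  have nonneg: "0 \<le> M v \<bullet> v" for v
  proof -
    have "\<bar>(hessian f l *v v) \<bullet> v\<bar> \<le> L * norm v * norm v"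
      using Cauchy_Schwarz_ineq2[of "hessian f l *v v" v] mult_right_mono[OF hessian_bound[of l v], of "norm v"]
      by simp
    then have "- (\<gamma> * (L * norm v * norm v)) \<le> \<gamma> * ((hessian f l *v v) \<bullet> v)"
      using \<gamma> by (smt (verit) mult_left_mono mult_minus_right)
    moreover have "\<gamma> * L * (norm v)\<^sup>2 \<le> 1 * (norm v)\<^sup>2"
      using \<gamma>L by (intro mult_right_mono) auto
    ultimately show ?thesis
      by (simp add: M_def inner_simps power2_norm_eq_inner[symmetric] power2_eq_square mult.assoc)
  qed
  obtain e where "(hessian f l *v e) \<bullet> e < 0"
    using assms negative_lambda_min_direction[OF hessian_symmetric] unfolding strict_saddle_points_def by blast
  then have e: "M e \<bullet> e < e \<bullet> e"
    using \<gamma> by (simp add: M_def inner_simps mult_pos_neg)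
  obtain \<rho> \<epsilon> where \<rho>: "\<rho> > 1" and \<epsilon>: "\<epsilon> > 0" and unstable: "\<And>(d :: nat \<Rightarrow> real^'n) t.
       (\<And>k. norm (M (d (k + 2)) - (1 + \<beta>) *\<^sub>R d (k + 1) + \<beta> *\<^sub>R d k) \<le> \<epsilon> * norm (d (k + 2))) \<Longrightarrow>
       bounded (range d) \<Longrightarrow> d 0 = t *\<^sub>R e \<Longrightarrow> d 1 = \<rho> *\<^sub>R d 0 \<Longrightarrow> t = 0"
    by (rule heavy_ball_linear_instability[OF linM symM nonneg e \<beta>]) blast
  obtain r where r: "r > 0" and almost: "\<And>x y. x \<in> cball l r \<Longrightarrow> y \<in> cball l r \<Longrightarrow>
      norm (prox_inverse x - prox_inverse y - M (x - y)) \<le> \<epsilon> * norm (x - y)"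
    unfolding M_def using prox_inverse_almost_linear[OF \<epsilon>, of l] by blast
  define S where "S = {z. \<forall>k. orbit (fst z) (snd z) k \<in> cball l r}"
  have "closed S"
  proof -
    have "S = (\<Inter>k. (\<lambda>z. orbit (fst z) (snd z) k) -` cball l r)"
      by (auto simp: S_def)
    then show ?thesis
      using orbit_continuous by (auto intro!: closed_INT closed_vimage)
  qed
  moreover have "bounded S"
  proof (rule bounded_subset[of "cball l r \<times> cball l r"])
    show "S \<subseteq> cball l r \<times> cball l r"
    proof
      fix z assume "z \<in> S"
      then have "orbit (fst z) (snd z) 0 \<in> cball l r" "orbit (fst z) (snd z) (Suc 0) \<in> cball l r"
        unfolding S_def by blast+
      then show "z \<in> cball l r \<times> cball l r"
        by (simp add: mem_Times_iff)
    qed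
  qed (intro bounded_Times bounded_cball)
  ultimately have "compact S"
    by (simp add: compact_eq_bounded_closed)
  then have "negligible S"
  proof (rule negligible_if_lines_meet_once[where v = "(e, \<rho> *\<^sub>R e)"])
    fix z t assume z: "z \<in> S" and z': "z + t *\<^sub>R (e, \<rho> *\<^sub>R e) \<in> S"
    define x y where "x = orbit (fst z + t *\<^sub>R e) (snd z + t *\<^sub>R \<rho> *\<^sub>R e)" and "y = orbit (fst z) (snd z)"
    have in_ball: "x k \<in> cball l r" "y k \<in> cball l r" for k
      using z z' by (simp_all add: S_def x_def y_def)
    define d where "d k = x k - y k" for k
    show "t = 0"
    proof (rule unstable[of d])
      fix k
      have "M (d (k + 2)) - (1 + \<beta>) *\<^sub>R d (k + 1) + \<beta> *\<^sub>R d k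
          = - (prox_inverse (x (k + 2)) - prox_inverse (y (k + 2)) - M (x (k + 2) - y (k + 2)))"
        unfolding x_def y_def d_def orbit_recurrence by (simp add: algebra_simps)
      then have "norm (M (d (k + 2)) - (1 + \<beta>) *\<^sub>R d (k + 1) + \<beta> *\<^sub>R d k)
          = norm (prox_inverse (x (k + 2)) - prox_inverse (y (k + 2)) - M (x (k + 2) - y (k + 2)))"
        by (simp only: norm_minus_cancel)
      then show "norm (M (d (k + 2)) - (1 + \<beta>) *\<^sub>R d (k + 1) + \<beta> *\<^sub>R d k) \<le> \<epsilon> * norm (d (k + 2))"
        using almost[OF in_ball, of "k + 2" "k + 2"] by (simp only: d_def)
    next
      have "norm (d k) \<le> 2 * r" for k
        using in_ball[of k] dist_triangle3[of "x k" "y k" l] by (simp add: d_def dist_norm[symmetric])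
      then show "bounded (range d)"
        unfolding bounded_iff by blast
    qed (simp_all add: d_def x_def y_def)
  qed
  moreover have "S = {(x0, x1). \<forall>k. orbit x0 x1 k \<in> cball l r}"
    by (auto simp: S_def)
  ultimately show ?thesis
    using that r by simp
qed

section \<open>Initial pairs that converge to a strict saddle\<close>

text \<open>
  One step of the algorithm on pairs of consecutive iterates is inverted by solving the
  recurrence for the older iterate. The inverse involves only \<open>prox_inverse\<close>, so it is
  differentiable and maps null sets to null sets.
\<close>

lemma negligible_eventual_orbits:
  assumes "negligible A"
  shows "negligible {(x0, x1). (orbit x0 x1 n, orbit x0 x1 (Suc n)) \<in> A}"
  using assms
proof (induction n)
  case 0
  then show ?case by simp
next
  case (Suc n)
  define predecessor where "predecessor w = ((1 / \<beta>) *\<^sub>R ((1 + \<beta>) *\<^sub>R fst w - prox_inverse (snd w)), fst w)"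
    for w :: "(real^'n) \<times> (real^'n)"
  define N where "N = {(x0, x1). (orbit x0 x1 n, orbit x0 x1 (Suc n)) \<in> A}"
  have "{(x0, x1). (orbit x0 x1 (Suc n), orbit x0 x1 (Suc (Suc n))) \<in> A} \<subseteq> predecessor ` N"
  proof safe
    fix x0 x1 assume "(orbit x0 x1 (Suc n), orbit x0 x1 (Suc (Suc n))) \<in> A"
    then have "(x1, orbit x0 x1 2) \<in> N"
      by (simp only: N_def orbit_shift[of x0 x1] mem_Collect_eq prod.case)
    moreover have "predecessor (x1, orbit x0 x1 2) = (x0, x1)"
      using orbit_recurrence[of x0 x1 0] \<beta> by (simp add: predecessor_def numeral_2_eq_2)
    ultimately show "(x0, x1) \<in> predecessor ` N"
      by (metis image_eqI)
  qed
  moreover have "negligible (predecessor ` N)"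
  proof (rule negligible_differentiable_image_negligible)
    have "predecessor differentiable (at w)" for w
    proof -
      have "(\<lambda>w. grad f (snd w)) differentiable (at w)" for w :: "(real^'n) \<times> (real^'n)"
        using has_derivative_compose[OF has_derivative_snd[OF has_derivative_ident] grad_derivative]
        unfolding differentiable_def by blast
      then show ?thesis
        unfolding predecessor_def prox_inverse_def
        by (intro derivative_intros bounded_linear_imp_differentiable[OF bounded_linear_fst]
              bounded_linear_imp_differentiable[OF bounded_linear_snd])
    qed
    then show "predecessor differentiable_on N"
      by (simp add: differentiable_on_def differentiable_at_withinI)
    show "negligible N"
      unfolding N_def using Suc by blast
  qed simp
  ultimately show ?case
    by (rule negligible_subset[rotated])
qed

text \<open>
  Countably many of the balls around strict saddles already cover all strict saddles, and an
  orbit converging to one of these points eventually stays in one ball of the countable family.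
\<close>

lemma negligible_W_hbppa: "negligible (W_hbppa f \<gamma> \<beta>)"
proof -
  define X where "X = strict_saddle_points f"
  have "\<forall>l\<in>X. \<exists>r. r > 0 \<and> negligible {(x0, x1). \<forall>k. orbit x0 x1 k \<in> cball l r}"
  proof
    fix l assume "l \<in> X"
    then show "\<exists>r. r > 0 \<and> negligible {(x0, x1). \<forall>k. orbit x0 x1 k \<in> cball l r}"
      using negligible_orbits_near_strict_saddle[of l] unfolding X_def by blast
  qed
  from bchoice[OF this] obtain r where r: "\<And>l. l \<in> X \<Longrightarrow> r l > 0"
    and neg: "\<And>l. l \<in> X \<Longrightarrow> negligible {(x0, x1). \<forall>k. orbit x0 x1 k \<in> cball l (r l)}"
    by blast
  obtain \<F> where \<F>: "\<F> \<subseteq> (\<lambda>l. ball l (r l)) ` X" "countable \<F>" "\<Union>\<F> = (\<Union>l\<in>X. ball l (r l))"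
    using Lindelof[of "(\<lambda>l. ball l (r l)) ` X"] by auto
  then obtain C where C: "C \<subseteq> X" "countable C" "\<F> = (\<lambda>l. ball l (r l)) ` C"
    using countable_subset_image[of \<F> "\<lambda>l. ball l (r l)" X] by blast
  define T where "T l = {(x0, x1). \<forall>k. orbit x0 x1 k \<in> cball l (r l)}" for l
  define N where "N l n = {(x0, x1). (orbit x0 x1 n, orbit x0 x1 (Suc n)) \<in> T l}" for l n
  have "W_hbppa f \<gamma> \<beta> \<subseteq> (\<Union>l\<in>C. \<Union>n. N l n)"
  proof
    fix z assume "z \<in> W_hbppa f \<gamma> \<beta>"
    then obtain x0 x1 l where z: "z = (x0, x1)" and l: "l \<in> X" and lim: "orbit x0 x1 \<longlonglongrightarrow> l"
      unfolding W_hbppa_def X_def by blast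
    have "l \<in> (\<Union>l\<in>X. ball l (r l))"
      using l r by (intro UN_I[OF l]) simp
    then obtain c where c: "c \<in> C" "l \<in> ball c (r c)"
      unfolding \<F>(3)[symmetric] C(3) by blast
    have "\<forall>\<^sub>F k in sequentially. orbit x0 x1 k \<in> ball c (r c)"
      using lim c(2) by (intro topological_tendstoD) auto
    then obtain n where n: "\<And>k. n \<le> k \<Longrightarrow> orbit x0 x1 k \<in> ball c (r c)"
      unfolding eventually_sequentially by blast
    have tail: "orbit (orbit x0 x1 n) (orbit x0 x1 (Suc n)) k = orbit x0 x1 (n + k)" for n k
    proof (induction n arbitrary: x0 x1)
      case (Suc n)
      show ?case
        using Suc[of x1 "orbit x0 x1 2"] by (simp only: orbit_shift[of x0 x1] add_Suc)
    qed simp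
    have "orbit (orbit x0 x1 n) (orbit x0 x1 (Suc n)) k \<in> cball c (r c)" for k
      using n[of "n + k"] by (simp add: tail del: mem_ball mem_cball) (use ball_subset_cball in blast)
    then have "z \<in> N c n"
      by (simp add: z N_def T_def del: hbppa.simps)
    then show "z \<in> (\<Union>l\<in>C. \<Union>n. N l n)"
      using c(1) by blast
  qed
  moreover have "negligible (\<Union>l\<in>C. \<Union>n. N l n)"
  proof -
    have "negligible (N l n)" if "l \<in> C" for l n
      unfolding N_def T_def using neg C(1) that by (intro negligible_eventual_orbits) blast
    then have "negligible (\<Union>n. N l n)" if "l \<in> C" for l
      using that by (intro negligible_Union_nat) blast
    then show ?thesis
      using C(2) by (intro negligible_countable_Union) auto
  qed
  ultimately show ?thesis
    by (rule negligible_subset[rotated])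
qed

end

theorem lemma4:
  fixes f :: "real^'n \<Rightarrow> real" and L \<beta> \<gamma> :: real
  assumes "twice_continuously_differentiable f"
    and "L > 0"
    and "\<And>x. spectral_norm (hessian f x) \<le> L"
    and "bdd_below (range f)"
    and "0 < \<beta>" and "\<beta> < 1 / 2"
    and "0 < \<gamma>" and "\<gamma> < 1 / L"
  shows "W_hbppa f \<gamma> \<beta> \<in> null_sets lebesgue"
proof -
  interpret heavy_ball_prox f L \<beta> \<gamma>
    using assms by unfold_locales
  show ?thesis
    using negligible_W_hbppa by (simp add: negligible_iff_null_sets)
qed

end
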